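(* Let $\mathcal D$ be the set of nonempty integer partitions into distinct parts. For $\lambda \in \mathcal D$ let $o(\lambda)$ be the number of odd parts in $\lambda$, $e(\lambda)$ the number of even parts in $\lambda$, and $per(\lambda)$ the perimeter of $\lambda$. Then, as formal power series, \[F(x, y, q) := \sum_{\lambda \in \mathcal D}x^{o(\lambda)}y^{e(\lambda)} q^{per(\lambda)} = \frac{xq + yq^2 + xyq^3}{1 - q^2(1 + xq)(1 + yq)}.\]
   Context: An integer partition is a weakly decreasing finite sequence $\lambda = (\lambda_1, \ldots, \lambda_m)$ of positive integers (its parts); $\ell(\lambda) := m$ is its length. The perimeter of a nonempty partition is $per(\lambda) := \lambda_1 + \ell(\lambda) - 1$. *)

theory Defs
  imports
    "HOL-Analysis.Infinite_Sum"
    "HOL-Computational_Algebra.Formal_Power_Series"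
begin

definition is_partition :: "nat list \<Rightarrow> bool" where
  "is_partition l \<longleftrightarrow> sorted_wrt (\<ge>) l \<and> (\<forall>i\<in>set l. i > 0)"

(* The truncated subtraction is harmless: per is only meant for nonempty lists. *)
definition per :: "nat list \<Rightarrow> nat" where
  "per l = hd l + length l - 1"

definition distinct_partitions :: "nat list set" where
  "distinct_partitions = {l. is_partition l \<and> l \<noteq> [] \<and> distinct l}"

definition num_odd :: "nat list \<Rightarrow> nat" where
  "num_odd l = length (filter odd l)"

definition num_even :: "nat list \<Rightarrow> nat" where
  "num_even l = length (filter even l)"

(* The ring of formal power series in x, y, q over the rationals is represented as
   Q[[x]][[y]][[q]], i.e. x is the innermost and q the outermost variable. *)
type_synonym fps_xyq = "rat fps fps fps"

definition var_x :: fps_xyq where "var_x = fps_const (fps_const fps_X)"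
definition var_y :: fps_xyq where "var_y = fps_const fps_X"
definition var_q :: fps_xyq where "var_q = fps_X"

definition partition_term :: "nat list \<Rightarrow> fps_xyq" where
  "partition_term l = var_x ^ num_odd l * var_y ^ num_even l * var_q ^ per l"

(* The formal infinite sum is taken in the library topology of formal power series,
   here the q-adic one: a net of series converges iff, for each n, its coefficient of
   q ^ n (a series in x and y) is eventually constant. As infsum is 0 for families that
   are not summable, statements about F should also assert summability. *)
definition F :: fps_xyq where
  "F = (\<Sum>\<^sub>\<infinity>l\<in>distinct_partitions. partition_term l)"

end

theory Submission
  imports Defs
begin

unbundle fps_syntax

text \<open>
  The parts 1 and 2 of a partition into distinct parts form one of the lists [], [1], [2], [2,1].
  If other parts remain, subtracting 2 from each of them gives again a nonempty partition into
  distinct parts with the same numbers of odd and even parts, and the perimeter drops by 2 plus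
  the number of removed parts. Hence $F = N + q^2 (1 + xq)(1 + yq) F$, where $N$ collects the
  partitions [1], [2], [2,1].
\<close>

section \<open>Topology and division of formal power series\<close>

text \<open>A coefficient of a sum depends on one coefficient of each summand. Continuity of
  addition is what allows \<open>has_sum\<close> statements to be combined over disjoint
  unions.\<close>

instance fps :: (ab_group_add) topological_comm_monoid_add
proof
  fix a b :: "'a fps"
  show "LIM z (nhds a \<times>\<^sub>F nhds b). fst z + snd z :> nhds (a + b)"
  proof (rule tendsto_fpsI)
    fix n
    have "\<forall>\<^sub>F z in nhds a \<times>\<^sub>F nhds b. fst z $ n = a $ n"
      using filterlim_fst[of "nhds a" "nhds b"] unfolding tendsto_fps_iff by blast
    moreover have "\<forall>\<^sub>F z in nhds a \<times>\<^sub>F nhds b. snd z $ n = b $ n"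
      using filterlim_snd[of "nhds b" "nhds a"] unfolding tendsto_fps_iff by blast
    ultimately show "\<forall>\<^sub>F z in nhds a \<times>\<^sub>F nhds b. (fst z + snd z) $ n = (a + b) $ n"
      by eventually_elim simp
  qed
qed

text \<open>Coefficient \<open>n\<close> of a product involves only the finitely many coefficients
  up to \<open>n\<close> of each factor, and these are eventually constant together. This allows a
  constant factor to be pulled out of an infinite sum.\<close>

instance fps :: (ring) topological_semigroup_mult
proof
  fix a b :: "'a fps"
  show "LIM z (nhds a \<times>\<^sub>F nhds b). fst z * snd z :> nhds (a * b)"
  proof (rule tendsto_fpsI)
    fix n
    have "\<forall>\<^sub>F z in nhds a \<times>\<^sub>F nhds b. \<forall>i\<in>{..n}. fst z $ i = a $ i"
      using filterlim_fst[of "nhds a" "nhds b"]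
      unfolding tendsto_fps_iff by (intro eventually_ball_finite) auto
    moreover have "\<forall>\<^sub>F z in nhds a \<times>\<^sub>F nhds b. \<forall>i\<in>{..n}. snd z $ i = b $ i"
      using filterlim_snd[of "nhds b" "nhds a"]
      unfolding tendsto_fps_iff by (intro eventually_ball_finite) auto
    ultimately show "\<forall>\<^sub>F z in nhds a \<times>\<^sub>F nhds b. (fst z * snd z) $ n = (a * b) $ n"
      by eventually_elim (auto simp: fps_mult_nth intro!: sum.cong)
  qed
qed

text \<open>Coefficient \<open>n\<close> of the partial sums no longer changes once the finite index
  set contains all indices that contribute to it.\<close>

lemma fps_summable_on:
  fixes f :: "'i \<Rightarrow> 'a::ab_group_add fps"
  assumes "\<And>n. finite {i \<in> A. f i $ n \<noteq> 0}"
  shows "f summable_on A"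
proof -
  define S where "S = Abs_fps (\<lambda>n. \<Sum>i | i \<in> A \<and> f i $ n \<noteq> 0. f i $ n)"
  have "(f has_sum S) A"
    unfolding has_sum_def
  proof (rule tendsto_fpsI)
    fix n
    have "sum f I $ n = S $ n"
      if "finite I" "{i \<in> A. f i $ n \<noteq> 0} \<subseteq> I" "I \<subseteq> A" for I
      unfolding S_def fps_sum_nth fps_nth_Abs_fps
      by (rule sum.mono_neutral_right) (use that in auto)
    then show "\<forall>\<^sub>F I in finite_subsets_at_top A. sum f I $ n = S $ n"
      unfolding eventually_finite_subsets_at_top
      using assms[of n] by (intro exI[of _ "{i \<in> A. f i $ n \<noteq> 0}"]) auto
  qed
  then show ?thesis
    by (rule has_sum_imp_summable)
qed

text \<open>The coefficients, here series in x and y, need not form a field. The inverse of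
  \<open>g\<close> is built from \<open>inverse (g $ 0)\<close>, and class \<open>inverse\<close>
  has no axioms, so \<open>inverse 1 = 1\<close> is what makes it a genuine inverse.\<close>

lemma fps_eq_divideI:
  fixes f g h :: "'a::{comm_ring_1,inverse} fps"
  assumes "f * g = h" and "g $ 0 = 1" and "inverse (1::'a) = 1"
  shows "f = h / g"
proof -
  have "g * inverse g = 1"
    using fps_right_inverse[of g 1] assms by (simp add: fps_inverse_def)
  then have "h * inverse g = f"
    using assms(1) by (metis mult.assoc mult.right_neutral)
  moreover have "h / g = h * inverse g"
    using assms(2) by (intro fps_divide_unit) simp
  ultimately show ?thesis by simp
qed

section \<open>Summability of the generating function\<close>

text \<open>The largest part and the length are both at least 1, so each of them is at most the
  perimeter.\<close>

lemma finite_distinct_partitions_per: "finite {l \<in> distinct_partitions. per l = n}"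
proof (rule finite_subset)
  show "finite {l. set l \<subseteq> {..n} \<and> length l \<le> n}"
    by (rule finite_lists_length_le) simp
  show "{l \<in> distinct_partitions. per l = n} \<subseteq> {l. set l \<subseteq> {..n} \<and> length l \<le> n}"
  proof clarify
    fix l assume "l \<in> distinct_partitions"
    then obtain a k where "l = a # k" "a > 0" "\<forall>b\<in>set k. b \<le> a"
      by (cases l) (auto simp: distinct_partitions_def is_partition_def)
    then show "set l \<subseteq> {..per l} \<and> length l \<le> per l"
      by (fastforce simp: per_def)
  qed
qed

lemma partition_term_nth:
  "partition_term l $ n =
     (if n = per l then fps_const fps_X ^ num_odd l * fps_X ^ num_even l else 0)"
proof -
  have "partition_term l = fps_const (fps_const fps_X ^ num_odd l * fps_X ^ num_even l) * fps_X ^ per l"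
    by (simp add: partition_term_def var_x_def var_y_def var_q_def fps_const_power)
  then show ?thesis
    by (simp add: fps_X_power_mult_right_nth)
qed

lemma summable_partition_term: "partition_term summable_on distinct_partitions"
proof (rule fps_summable_on)
  show "finite {l \<in> distinct_partitions. partition_term l $ n \<noteq> 0}" for n
    by (rule finite_subset[OF _ finite_distinct_partitions_per[of n]])
      (auto simp: partition_term_nth)
qed

section \<open>Splitting off the parts 1 and 2\<close>

definition small_parts :: "nat list set" where
  "small_parts = {[], [1], [2], [2, 1]}"

text \<open>This inverts the removal of the parts 1 and 2; adding 2 preserves parities.\<close>

definition lift_append :: "nat list \<Rightarrow> nat list \<Rightarrow> nat list" where
  "lift_append s l = map ((+) 2) l @ s"

text \<open>Shifted positive parts are at least 3, so \<open>s\<close> can be read off from the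
  result. Hence lifts with different \<open>s\<close> never coincide.\<close>

lemma filter_lift_append:
  assumes "l \<in> distinct_partitions" "s \<in> small_parts"
  shows "filter (\<lambda>i. i \<le> 2) (lift_append s l) = s"
proof -
  have "filter (\<lambda>i. i \<le> 2) (map ((+) 2) l) = []"
    using assms(1) by (auto simp: filter_empty_conv distinct_partitions_def is_partition_def)
  moreover have "filter (\<lambda>i. i \<le> 2) s = s"
    using assms(2) by (auto simp: small_parts_def)
  ultimately show ?thesis
    by (simp add: lift_append_def)
qed

lemma lift_append_in_distinct_partitions:
  assumes "l \<in> distinct_partitions" "s \<in> small_parts"
  shows "lift_append s l \<in> distinct_partitions"
  using assms
  by (auto simp: distinct_partitions_def is_partition_def lift_append_def small_parts_def
      sorted_wrt_append sorted_wrt_map distinct_map)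

lemma in_small_partsI:
  assumes "sorted_wrt (\<ge>) s" "distinct s" "set s \<subseteq> {1, 2}"
  shows "s \<in> small_parts"
proof -
  \<comment> \<open>Three strictly decreasing entries do not fit into {1, 2}, so the last case is
    contradictory.\<close>
  consider "s = []" | a where "s = [a]" | a b where "s = [a, b]"
    | a b c t where "s = a # b # c # t"
    by (metis list.exhaust)
  then show ?thesis
    by cases (use assms in \<open>auto simp: small_parts_def\<close>)
qed

text \<open>After the first entry that is at most \<open>m\<close>, all entries are at most
  \<open>m\<close>.\<close>

lemma sorted_wrt_ge_split:
  fixes l :: "nat list"
  assumes "sorted_wrt (\<ge>) l"
  shows "filter (\<lambda>i. i > m) l @ filter (\<lambda>i. i \<le> m) l = l"
  using assms
proof (induction l)
  case (Cons a l)
  show ?case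
  proof (cases "a > m")
    case False
    then have "filter (\<lambda>i. i > m) l = []" "filter (\<lambda>i. i \<le> m) l = l"
      using Cons.prems by (auto simp: filter_empty_conv filter_id_conv)
    then show ?thesis using False by simp
  qed (use Cons in auto)
qed simp

text \<open>The three explicit lists are the nonempty members of \<open>small_parts\<close>. They
  stand apart because a lift of a nonempty list always has a part above 2.\<close>

lemma distinct_partitions_decompose:
  "distinct_partitions =
     {[1], [2], [2, 1]} \<union> (\<Union>s\<in>small_parts. lift_append s ` distinct_partitions)"
proof (intro equalityI subsetI)
  fix l assume l: "l \<in> distinct_partitions"
  define s where "s = filter (\<lambda>i. i \<le> 2) l"
  define b where "b = filter (\<lambda>i. i > 2) l"
  have split: "l = b @ s"
    using l sorted_wrt_ge_split[of l 2]
    by (simp add: b_def s_def distinct_partitions_def is_partition_def)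
  have s: "s \<in> small_parts"
  proof (rule in_small_partsI)
    show "set s \<subseteq> {1, 2}"
    proof
      fix i assume "i \<in> set s"
      then have "i > 0" "i \<le> 2"
        using l by (auto simp: s_def distinct_partitions_def is_partition_def)
      then show "i \<in> {1, 2}" by auto
    qed
  qed (use l in \<open>auto simp: s_def distinct_partitions_def is_partition_def sorted_wrt_filter\<close>)
  show "l \<in> {[1], [2], [2, 1]} \<union> (\<Union>s\<in>small_parts. lift_append s ` distinct_partitions)"
  proof (cases "b = []")
    case True
    then have "l = s" "l \<noteq> []"
      using split l by (auto simp: distinct_partitions_def)
    then show ?thesis
      using s by (auto simp: small_parts_def)
  next
    case False
    \<comment> \<open>All entries of \<open>b\<close> exceed 2, so the truncated subtraction is
      exact and injective on them and leaves positive parts.\<close>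
    define c where "c = map (\<lambda>i. i - 2) b"
    have big: "i > 2" if "i \<in> set b" for i
      using that by (simp add: b_def)
    have "map ((+) 2) c = b"
      unfolding c_def map_map by (rule map_idI) (use big in \<open>fastforce\<close>)
    then have "l = lift_append s c"
      using split by (simp add: lift_append_def)
    moreover have "c \<in> distinct_partitions"
    proof -
      have b: "sorted_wrt (\<ge>) b" "distinct b"
        using l by (auto simp: b_def distinct_partitions_def is_partition_def sorted_wrt_filter)
      have "sorted_wrt (\<ge>) c"
        unfolding c_def sorted_wrt_map
        by (rule sorted_wrt_mono_rel[OF _ b(1)]) (rule diff_le_mono)
      moreover have "inj_on (\<lambda>i. i - 2) (set b)"
        by (rule inj_onI) (metis big less_imp_le le_add_diff_inverse)
      then have "distinct c"
        using b(2) by (simp add: c_def distinct_map)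
      moreover have "\<forall>i\<in>set c. i > 0" "c \<noteq> []"
        using False big by (auto simp: c_def)
      ultimately show ?thesis
        by (simp add: distinct_partitions_def is_partition_def)
    qed
    ultimately show ?thesis
      using s by blast
  qed
next
  fix l assume "l \<in> {[1], [2], [2, 1]} \<union> (\<Union>s\<in>small_parts. lift_append s ` distinct_partitions)"
  then consider "l \<in> {[1], [2], [2, 1]}"
    | s k where "s \<in> small_parts" "k \<in> distinct_partitions" "l = lift_append s k"
    by blast
  then show "l \<in> distinct_partitions"
  proof cases
    case 1
    then show ?thesis by (auto simp: distinct_partitions_def is_partition_def)
  qed (simp add: lift_append_in_distinct_partitions)
qed

section \<open>Functional equation and closed form\<close>

text \<open>As \<open>l\<close> is nonempty, the head of the lift comes from \<open>l\<close> and
  grows by 2, while \<open>s\<close> adds only its length to the perimeter.\<close>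

lemma partition_term_lift_append:
  assumes "l \<noteq> []"
  shows "partition_term (lift_append s l) =
    var_q ^ 2 * (var_x ^ num_odd s * var_y ^ num_even s * var_q ^ length s) * partition_term l"
proof -
  obtain a k where l: "l = a # k"
    using assms by (cases l) auto
  have "num_odd (lift_append s l) = num_odd s + num_odd l"
       "num_even (lift_append s l) = num_even s + num_even l"
    by (simp_all add: num_odd_def num_even_def lift_append_def filter_map o_def)
  moreover have "per (lift_append s l) = 2 + length s + per l"
    by (simp add: l per_def lift_append_def)
  ultimately show ?thesis
    by (simp only: partition_term_def power_add) (simp only: ac_simps)
qed

lemma F_functional_equation:
  "F = (var_x * var_q + var_y * var_q ^ 2 + var_x * var_y * var_q ^ 3)
     + var_q ^ 2 * (1 + var_x * var_q) * (1 + var_y * var_q) * F"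
proof -
  define D where "D = distinct_partitions"
  \<comment> \<open>Unlike \<open>partition_term s\<close>, this weight has exponent
    \<open>length s\<close> at q, since below larger parts each small part costs 1 in
    perimeter.\<close>
  define w where "w s = var_x ^ num_odd s * var_y ^ num_even s * var_q ^ length s" for s
  have F: "(partition_term has_sum F) D"
    unfolding F_def D_def by (rule has_sum_infsum[OF summable_partition_term])
  have lift: "(partition_term has_sum (var_q ^ 2 * w s * F)) (lift_append s ` D)" for s
  proof -
    have "inj_on (lift_append s) D"
      by (auto simp: inj_on_def lift_append_def)
    moreover have "((\<lambda>l. var_q ^ 2 * w s * partition_term l) has_sum (var_q ^ 2 * w s * F)) D"
      by (rule has_sum_cmult_right[OF F])
    then have "(partition_term \<circ> lift_append s has_sum (var_q ^ 2 * w s * F)) D"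
      by (rule has_sum_cong[THEN iffD1, rotated])
        (simp add: D_def distinct_partitions_def partition_term_lift_append w_def)
    ultimately show ?thesis
      by (simp add: has_sum_reindex)
  qed
  have lifts: "(partition_term has_sum (\<Sum>s\<in>small_parts. var_q ^ 2 * w s * F))
          (\<Union>s\<in>small_parts. lift_append s ` D)"
  proof (rule sum_has_sum)
    show "lift_append s ` D \<inter> lift_append t ` D = {}"
      if "s \<in> small_parts" "t \<in> small_parts" "s \<noteq> t" for s t
    proof -
      have "lift_append s k \<noteq> lift_append t l" if "k \<in> D" "l \<in> D" for k l
        using filter_lift_append[of k s] filter_lift_append[of l t] that
          \<open>s \<in> small_parts\<close> \<open>t \<in> small_parts\<close> \<open>s \<noteq> t\<close>
        unfolding D_def by metis
      then show ?thesis by blast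
    qed
    show "finite small_parts"
      by (simp add: small_parts_def)
  qed (rule lift)
  have disjoint: "{[1], [2], [2, 1]} \<inter> (\<Union>s\<in>small_parts. lift_append s ` D) = {}"
  proof -
    \<comment> \<open>The head of such a lift is at least 3.\<close>
    have "lift_append s l \<notin> {[1], [2], [2, 1]}" if "l \<in> D" for s l
      using that
      by (cases l) (auto simp: D_def lift_append_def distinct_partitions_def is_partition_def)
    then show ?thesis
      unfolding disjoint_iff UN_iff image_iff by metis
  qed
  have "(partition_term has_sum
      (sum partition_term {[1], [2], [2, 1]} + (\<Sum>s\<in>small_parts. var_q ^ 2 * w s * F))) D"
    using has_sum_Un_disjoint[OF has_sum_finite lifts disjoint]
    unfolding distinct_partitions_decompose[folded D_def, symmetric] by simp
  then have "F = sum partition_term {[1], [2], [2, 1]} + (\<Sum>s\<in>small_parts. var_q ^ 2 * w s * F)"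
    by (rule has_sum_unique[OF F])
  also have "sum partition_term {[1], [2], [2, 1]} =
      var_x * var_q + var_y * var_q ^ 2 + var_x * var_y * var_q ^ 3"
    by (simp add: partition_term_def num_odd_def num_even_def per_def numeral_3_eq_3 numeral_2_eq_2)
  also have "(\<Sum>s\<in>small_parts. var_q ^ 2 * w s * F) = var_q ^ 2 * (\<Sum>s\<in>small_parts. w s) * F"
    by (simp only: sum_distrib_left sum_distrib_right)
  \<comment> \<open>The four weights are 1, xq, yq and xyq^2: the parts 1 and 2 are chosen
    independently.\<close>
  also have "(\<Sum>s\<in>small_parts. w s) = (1 + var_x * var_q) * (1 + var_y * var_q)"
    by (simp add: small_parts_def w_def num_odd_def num_even_def distrib_left distrib_right mult_ac)
  finally show ?thesis
    by (simp only: mult.assoc)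
qed

theorem theorem4p1:
  shows "partition_term summable_on distinct_partitions \<and>
    F = (var_x * var_q + var_y * var_q ^ 2 + var_x * var_y * var_q ^ 3) /
        (1 - var_q ^ 2 * (1 + var_x * var_q) * (1 + var_y * var_q))"
proof (intro conjI fps_eq_divideI)
  show "F * (1 - var_q ^ 2 * (1 + var_x * var_q) * (1 + var_y * var_q)) =
      var_x * var_q + var_y * var_q ^ 2 + var_x * var_y * var_q ^ 3"
    using F_functional_equation by (simp add: algebra_simps)
  \<comment> \<open>The subtracted series is a multiple of q^2, so it has no constant term in
    q.\<close>
  show "(1 - var_q ^ 2 * (1 + var_x * var_q) * (1 + var_y * var_q)) $ 0 = 1"
    by (simp add: var_q_def)
  show "inverse (1 :: rat fps fps) = 1"
    by (intro fps_inverse_one') simp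
qed (rule summable_partition_term)

end
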